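(* Let $\mathbf F_\theta=\{A\in\mathrm{Sym}^2(\mathbb R^n):\mathrm{tr}(\arctan A)\ge\theta\}$ for $\theta\in(-n\frac\pi2,n\frac\pi2)$, and let $\overrightarrow{\mathbf F}_\theta$ be its asymptotic subequation. (1) If $\theta\in I_k=\left((n-2k)\frac{\pi}{2},\,(n-2(k-1))\frac{\pi}{2}\right)$ for some $k\in\{1,\dots,n\}$, then $$\mathrm{Int}\,\overrightarrow{\mathbf F}_\theta=\mathrm{Int}\,\mathbf\Lambda_k=\{A\in\mathrm{Sym}^2(\mathbb R^n):\lambda_k(A)>0\}.$$ (2) If $\theta=\theta_k=(n-2k)\frac\pi2$ for some $k\in\{1,\dots,n-1\}$, then (the set in question being equal to $\mathrm{Int}\,\mathbf\Lambda_k^{\sigma_{n-1}}$) $$\mathrm{Int}\,\overrightarrow{\mathbf F}_{\theta_k}=\left((\mathrm{Int}\,\mathbf\Lambda_{k+1})\cap\mathbf\Lambda_k\right)\cup E_k^\star,\qquad E_k^\star=\left((\mathrm{Int}\,\mathbf\Lambda_{k+1})\setminus\mathbf\Lambda_k\right)\cap\{A:\sigma_{n-1}(A)\,\sigma_n(A)<0\}.$$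
   Context: $\mathrm{Sym}^2(\mathbb R^n)$ is the space of real symmetric $n\times n$ matrices, $\lambda_1(A)\le\dots\le\lambda_n(A)$ are the ordered eigenvalues of $A$, $\mathrm{tr}(\arctan A)=\sum_i\arctan\lambda_i(A)$, and $\sigma_j(A)$ is the $j$-th elementary symmetric function of the eigenvalues. $\mathbf\Lambda_k:=\{A:\lambda_k(A)\ge0\}$ for $1\le k\le n$. For a closed set $\mathbf F\subset\mathrm{Sym}^2(\mathbb R^n)$ with $\mathbf F+\{P\ge0\}\subset\mathbf F$ (a subequation), the asymptotic interior of $\mathbf F$ is the set of all $A$ for which there exist $\epsilon>0$ and $t_0$ such that $t(A-\epsilon I)\in\mathbf F$ for all $t\ge t_0$; the asymptotic subequation $\overrightarrow{\mathbf F}$ is the closure of the asymptotic interior. For each $A$ the polynomial $t\mapsto\sigma_{n-1}(tI+A)$ has degree $n-1$ and only real roots; the negatives of its roots, in increasing order with multiplicity, are $\lambda_1^{\sigma_{n-1}}(A)\le\dots\le\lambda_{n-1}^{\sigma_{n-1}}(A)$, and $\mathbf\Lambda_k^{\sigma_{n-1}}:=\{A:\lambda_k^{\sigma_{n-1}}(A)\ge0\}$ for $1\le k\le n-1$. *)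

theory Defs
  imports "HOL-Analysis.Analysis" "HOL-Computational_Algebra.Polynomial" "HOL-Library.Multiset"
begin

text \<open>
  The dimension \<open>n\<close> is \<open>CARD('n)\<close>.  The topology of \<open>Sym2\<close> is the one induced by
  \<^typ>\<open>real^'n^'n\<close>; interiors and closures are always taken relative to \<open>Sym2\<close> (which has
  empty interior in \<^typ>\<open>real^'n^'n\<close> as soon as \<open>n > 1\<close>).
\<close>

definition Sym2 :: "(real^'n^'n) set" where
  "Sym2 = {A. transpose A = A}"

definition Int_Sym :: "(real^'n^'n) set \<Rightarrow> (real^'n^'n) set" where
  "Int_Sym S = top_of_set Sym2 interior_of S"

definition Cl_Sym :: "(real^'n^'n) set \<Rightarrow> (real^'n^'n) set" where
  "Cl_Sym S = top_of_set Sym2 closure_of S"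


definition charpoly :: "real^'n^'n \<Rightarrow> real poly" where
  "charpoly A = det (mat [:0, 1:] - (\<chi> i j. [:A $ i $ j:]))"

text \<open>
  The index \<open>k\<close> is 1-based and the eigenvalues are counted with algebraic multiplicity, so for
  \<open>A \<in> Sym2\<close> the list has length \<open>CARD('n)\<close>.  The value is only meaningful for
  \<open>A \<in> Sym2\<close> and \<open>1 \<le> k \<le> CARD('n)\<close>.
\<close>

definition eigval :: "nat \<Rightarrow> real^'n^'n \<Rightarrow> real" where
  "eigval k A = sorted_list_of_multiset (proots (charpoly A)) ! (k - 1)"

definition tr_arctan :: "real^'n^'n \<Rightarrow> real" where
  "tr_arctan A = (\<Sum>i = 1..CARD('n). arctan (eigval i A))"

definition sigma :: "nat \<Rightarrow> real^'n^'n \<Rightarrow> real" where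
  "sigma j A = (\<Sum>S | S \<subseteq> {1..CARD('n)} \<and> card S = j. \<Prod>i\<in>S. eigval i A)"

definition Lam :: "nat \<Rightarrow> (real^'n^'n) set" where
  "Lam k = {A \<in> Sym2. eigval k A \<ge> 0}"


text \<open>
  For \<open>A \<in> Sym2\<close>, \<open>sigma_poly A\<close> is the polynomial \<open>t \<mapsto> \<sigma>\<^bsub>n-1\<^esub>(t I + A)\<close>, of degree
  \<open>CARD('n) - 1\<close> and with only real roots; it is unique because a real polynomial is determined
  by its values.
\<close>

definition sigma_poly :: "real^'n^'n \<Rightarrow> real poly" where
  "sigma_poly A = (THE p. \<forall>t. poly p t = sigma (CARD('n) - 1) (mat t + A))"

definition sigma_eigval :: "nat \<Rightarrow> real^'n^'n \<Rightarrow> real" where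
  "sigma_eigval k A =
     sorted_list_of_multiset (image_mset uminus (proots (sigma_poly A))) ! (k - 1)"

definition sigma_Lam :: "nat \<Rightarrow> (real^'n^'n) set" where
  "sigma_Lam k = {A \<in> Sym2. sigma_eigval k A \<ge> 0}"


definition asymp_interior :: "(real^'n^'n) set \<Rightarrow> (real^'n^'n) set" where
  "asymp_interior F =
     {A \<in> Sym2. \<exists>\<epsilon>>0. \<exists>t0::real. \<forall>t\<ge>t0. t *\<^sub>R (A - mat \<epsilon>) \<in> F}"

definition asymp_subeq :: "(real^'n^'n) set \<Rightarrow> (real^'n^'n) set" where
  "asymp_subeq F = Cl_Sym (asymp_interior F)"


definition F_arctan :: "real \<Rightarrow> (real^'n^'n) set" where
  "F_arctan \<theta> = {A \<in> Sym2. tr_arctan A \<ge> \<theta>}"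

definition E_star :: "nat \<Rightarrow> (real^'n^'n) set" where
  "E_star k = (Int_Sym (Lam (k + 1)) - Lam k) \<inter>
     {A \<in> Sym2. sigma (CARD('n) - 1) A * sigma CARD('n) A < 0}"

end

theory Submission
  imports Defs "HOL-Real_Asymp.Real_Asymp"
begin

text \<open>
  By the min-max principle the ordered eigenvalues, and hence \<open>F_arctan \<theta>\<close> and its asymptotic
  interior \<open>U\<close>, are monotone in the Loewner order.  A set that is monotone and stable under a small
  shift \<open>A - \<epsilon> I\<close> is open and equals the interior of its closure, so everything reduces to computing
  \<open>U\<close>.  As \<open>t\<close> grows, \<open>\<Sum> arctan (t (\<lambda>\<^sub>i - \<epsilon>))\<close> tends to \<open>\<pi>/2\<close> times the signature of \<open>A - \<epsilon> I\<close>, which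
  settles the phases in the open intervals.  At \<open>\<theta>\<^sub>k\<close> the next term \<open>- (1/t) \<Sum> 1/(\<lambda>\<^sub>i - \<epsilon>)\<close> decides.  That
  sum is the logarithmic derivative of \<open>\<Prod> (\<lambda>\<^sub>i + x)\<close> at \<open>x = - \<epsilon>\<close>, and \<open>\<sigma>\<^bsub>n-1\<^esub>(x I + A)\<close> is the
  derivative of the product.  As the roots interlace, the sum is negative exactly when \<open>\<epsilon>\<close> lies below
  the \<open>k\<close>-th \<open>\<sigma>\<^bsub>n-1\<^esub>\<close>-eigenvalue, so \<open>U\<close> is the set where that eigenvalue is positive.
\<close>

subsection \<open>Spectral theorem and ordered eigenvalues\<close>

lemma Sym2_inner:
  assumes "A \<in> Sym2"
  shows "x \<bullet> (A *v y) = (A *v x) \<bullet> y"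
  using assms by (metis (mono_tags) Sym2_def dot_lmul_matrix mem_Collect_eq transpose_matrix_vector)

lemma Sym2_scaleR: "A \<in> Sym2 \<Longrightarrow> t *\<^sub>R A \<in> Sym2"
  by (simp add: Sym2_def transpose_def vec_eq_iff)

lemma Sym2_add_mat: "A \<in> Sym2 \<Longrightarrow> A + mat s \<in> Sym2"
  by (auto simp add: Sym2_def transpose_def vec_eq_iff mat_def)

lemma Sym2_diff_mat: "A \<in> Sym2 \<Longrightarrow> A - mat s \<in> Sym2"
  by (auto simp add: Sym2_def transpose_def vec_eq_iff mat_def)

lemma diff_mat: "A - mat s = A + mat (- s :: real)"
  by (simp add: vec_eq_iff mat_def)

lemma mat_vector_mul: "(mat s :: real^'n^'n) *v x = s *\<^sub>R x"
  by (simp add: matrix_vector_mult_def mat_def vec_eq_iff if_distrib[where f="\<lambda>c. c * _"] cong: if_cong)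

text \<open>A maximiser of the quadratic form on the unit sphere of \<open>S\<close> is an
  eigenvector: otherwise moving it along the residual \<open>u\<close>, which invariance keeps in
  \<open>S\<close>, would raise the Rayleigh quotient.\<close>

lemma invariant_subspace_eigenvector:
  fixes A :: "real^'n^'n"
  assumes A: "A \<in> Sym2" and S: "subspace S" "S \<noteq> {0}" and inv: "\<And>x. x \<in> S \<Longrightarrow> A *v x \<in> S"
  obtains v c where "v \<in> S" "norm v = 1" "A *v v = c *\<^sub>R v"
proof -
  obtain w where w: "w \<in> S" "w \<noteq> 0"
    using S subspace_0 by blast
  let ?K = "S \<inter> sphere 0 1"
  have "compact ?K"
    using closed_subspace[OF S(1)] by (simp add: closed_Int_compact)
  moreover have "w /\<^sub>R norm w \<in> ?K"
    using w S(1) by (simp add: subspace_scale)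
  moreover have "continuous_on ?K (\<lambda>x. x \<bullet> (A *v x))"
    by (intro continuous_intros)
  ultimately obtain v where v: "v \<in> ?K" and max: "\<And>y. y \<in> ?K \<Longrightarrow> y \<bullet> (A *v y) \<le> v \<bullet> (A *v v)"
    using continuous_attains_sup[of ?K "\<lambda>x. x \<bullet> (A *v x)"] by blast
  define c where "c = v \<bullet> (A *v v)"
  define u where "u = A *v v - c *\<^sub>R v"
  define h where "h x = x \<bullet> (A *v x) - c * (x \<bullet> x)" for x
  have vv: "v \<bullet> v = 1" and vS: "v \<in> S"
    using v by (auto simp: dot_square_norm)
  have uS: "u \<in> S"
    unfolding u_def using vS S(1) inv by (intro subspace_diff subspace_scale) auto
  have h_le: "h x \<le> 0" if "x \<in> S" for x
  proof (cases "x = 0")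
    case False
    have "x /\<^sub>R norm x \<in> ?K"
      using that False S(1) by (simp add: subspace_scale)
    from max[OF this] have "(x \<bullet> (A *v x)) / (norm x)\<^sup>2 \<le> c"
      by (simp add: c_def matrix_vector_mult_scaleR power2_eq_square divide_simps)
    then show ?thesis
      using False by (simp add: h_def dot_square_norm divide_simps)
  qed (simp add: h_def)
  have expand: "h (v + t *\<^sub>R u) = 2 * t * (u \<bullet> u) + t\<^sup>2 * h u" for t
  proof -
    have "v \<bullet> (A *v u) = u \<bullet> (A *v v)"
      using Sym2_inner[OF A] by (metis inner_commute)
    moreover have "u \<bullet> (A *v v) = u \<bullet> u + c * (u \<bullet> v)"
      by (simp add: u_def inner_diff_right inner_diff_left algebra_simps)
    ultimately show ?thesis
      by (simp add: h_def matrix_vector_right_distrib matrix_vector_mult_scaleR inner_add_left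
          inner_add_right algebra_simps power2_eq_square vv inner_commute[of v u] flip: c_def)
  qed
  have "u \<bullet> u = 0"
  proof (rule ccontr)
    assume "u \<bullet> u \<noteq> 0"
    then have pos: "u \<bullet> u > 0"
      by (metis inner_gt_zero_iff inner_zero_left)
    \<comment> \<open>Small enough that the quadratic term \<open>t\<^sup>2 * h u\<close> cannot
      outweigh the linear gain \<open>2 * t * (u \<bullet> u)\<close>.\<close>
    define t where "t = (u \<bullet> u) / (1 + \<bar>h u\<bar>)"
    have "t > 0"
      using pos by (simp add: t_def add_pos_nonneg)
    have "h (v + t *\<^sub>R u) \<le> 0"
      using vS uS S(1) by (intro h_le) (simp add: subspace_add subspace_scale)
    then have "t * (2 * (u \<bullet> u) + t * h u) \<le> 0"
      unfolding expand by (simp add: algebra_simps power2_eq_square)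
    then have "2 * (u \<bullet> u) + t * h u \<le> 0"
      using \<open>t > 0\<close> by (simp add: mult_le_0_iff)
    moreover have "t * \<bar>h u\<bar> \<le> u \<bullet> u"
      using pos by (simp add: t_def divide_simps)
    moreover have "- (t * \<bar>h u\<bar>) \<le> t * h u"
      using \<open>t > 0\<close> by (simp add: abs_if)
    ultimately show False
      using pos by linarith
  qed
  then have "A *v v = c *\<^sub>R v"
    by (simp add: u_def)
  then show thesis
    using that[OF vS, of c] v by simp
qed

text \<open>Induction on the dimension: the part of \<open>S\<close> orthogonal to one unit
  eigenvector has dimension one less and is again invariant, since \<open>A\<close> is
  symmetric.\<close>

lemma invariant_subspace_orthonormal_eigenvectors:
  fixes A :: "real^'n^'n"
  assumes A: "A \<in> Sym2" and "subspace S" and "\<And>x. x \<in> S \<Longrightarrow> A *v x \<in> S"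
  shows "\<exists>B\<subseteq>S. pairwise orthogonal B \<and> finite B \<and> card B = dim S \<and>
    (\<forall>v\<in>B. norm v = 1 \<and> (\<exists>c. A *v v = c *\<^sub>R v))"
  using assms(2,3)
proof (induction "dim S" arbitrary: S)
  case 0
  then show ?case
    by (intro exI[of _ "{}"]) auto
next
  case (Suc m)
  then have "S \<noteq> {0}"
    by auto
  then obtain v c where v: "v \<in> S" "norm v = 1" "A *v v = c *\<^sub>R v"
    using invariant_subspace_eigenvector[OF A Suc.prems(1) _ Suc.prems(2)] by blast
  define T where "T = {y \<in> S. \<forall>x \<in> span {v}. orthogonal x y}"
  have T_iff: "y \<in> T \<longleftrightarrow> y \<in> S \<and> v \<bullet> y = 0" for y
    by (auto simp: T_def span_singleton orthogonal_def intro: exI[of _ 1])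
  have "dim T + dim (span {v}) = dim S"
    unfolding T_def using v(1) Suc.prems(1)
    by (intro dim_subspace_orthogonal_to_vectors) (auto simp: span_minimal)
  moreover have "dim (span {v}) = 1"
    using v(2) by (subst dim_span, subst dim_singleton) auto
  ultimately have dimT: "dim T = m"
    using Suc.hyps(2) by simp
  have "subspace T"
    using Suc.prems(1) by (auto simp: subspace_def T_iff inner_add_right)
  moreover have "A *v x \<in> T" if "x \<in> T" for x
    using that Suc.prems(2) Sym2_inner[OF A, of v x] v(3) by (auto simp: T_iff)
  ultimately obtain B where B: "B \<subseteq> T" "pairwise orthogonal B" "finite B" "card B = m"
      "\<forall>v\<in>B. norm v = 1 \<and> (\<exists>c. A *v v = c *\<^sub>R v)"
    using Suc.hyps(1)[of T] dimT by metis
  have "v \<notin> B"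
    using B(1) v(2) by (metis T_iff in_mono inner_eq_zero_iff norm_zero zero_neq_one)
  moreover have "pairwise orthogonal (insert v B)"
    using B(1,2) by (auto simp: pairwise_insert orthogonal_def T_iff inner_commute)
  ultimately show ?case
    using B v Suc.hyps(2) by (intro exI[of _ "insert v B"]) (auto simp: T_iff)
qed

text \<open>Indexing by \<open>'n\<close> makes the orthonormal family a basis by counting. The
  eigenvalues \<open>d\<close> carry no order; \<open>eigval\<close> is compared with them through
  multisets of roots.\<close>

definition eigenbasis :: "real^'n^'n \<Rightarrow> ('n \<Rightarrow> real^'n) \<Rightarrow> ('n \<Rightarrow> real) \<Rightarrow> bool" where
  "eigenbasis A b d \<longleftrightarrow>
    (\<forall>i j. b i \<bullet> b j = (if i = j then 1 else 0)) \<and> (\<forall>i. A *v b i = d i *\<^sub>R b i)"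

theorem symmetric_eigenbasis_exists:
  fixes A :: "real^'n^'n"
  assumes "A \<in> Sym2"
  obtains b d where "eigenbasis A b d"
proof -
  obtain B :: "(real^'n) set" where B: "pairwise orthogonal B" "finite B" "card B = CARD('n)"
      "\<forall>v\<in>B. norm v = 1 \<and> (\<exists>c. A *v v = c *\<^sub>R v)"
    using invariant_subspace_orthonormal_eigenvectors[OF assms subspace_UNIV] by auto
  obtain b where b: "bij_betw b (UNIV :: 'n set) B"
    using B(2,3) finite_same_card_bij[of "UNIV :: 'n set" B] by auto
  have bB: "b i \<in> B" for i
    using b by (auto simp: bij_betw_def)
  have "b i \<bullet> b j = (if i = j then 1 else 0)" for i j
    using b B(1,4) bB[of i] bB[of j]
    by (cases "i = j") (auto simp: bij_betw_def inj_eq pairwise_def orthogonal_def dot_square_norm)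
  moreover have "\<forall>i. \<exists>c. A *v b i = c *\<^sub>R b i"
    using B(4) bB by blast
  then obtain d where "\<And>i. A *v b i = d i *\<^sub>R b i"
    by metis
  ultimately show thesis
    using that[of b d] by (simp add: eigenbasis_def)
qed

lemma eigenbasis_affine:
  assumes "eigenbasis A b d"
  shows "eigenbasis (t *\<^sub>R (A + mat s)) b (\<lambda>i. t * (d i + s))"
  using assms unfolding eigenbasis_def
  by (simp add: scaleR_matrix_vector_assoc[symmetric] mat_vector_mul algebra_simps)

lemma eigenbasis_independent:
  assumes "eigenbasis A b d"
  shows "inj b" "independent (b ` I)" "pairwise orthogonal (b ` I)" "dim (span (b ` I)) = card I"
proof -
  have b: "b i \<bullet> b j = (if i = j then 1 else 0)" for i j
    using assms by (simp add: eigenbasis_def)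
  show inj: "inj b"
    by (metis b inj_def zero_neq_one)
  show orth: "pairwise orthogonal (b ` I)"
    by (auto simp: pairwise_def orthogonal_def b)
  moreover have "0 \<notin> b ` I"
    using b by (metis imageE inner_zero_left zero_neq_one)
  ultimately show ind: "independent (b ` I)"
    by (rule pairwise_orthogonal_independent)
  show "dim (span (b ` I)) = card I"
    by (simp add: ind dim_eq_card_independent card_image inj_on_subset[OF inj])
qed

lemma eigenbasis_span_quadratic_form:
  assumes eb: "eigenbasis A b d" and x: "x \<in> span (b ` I)"
  shows "x \<bullet> (A *v x) = (\<Sum>i\<in>I. d i * (x \<bullet> b i)\<^sup>2)" and "x \<bullet> x = (\<Sum>i\<in>I. (x \<bullet> b i)\<^sup>2)"
proof -
  have b: "b i \<bullet> b j = (if i = j then 1 else 0)" and Ab: "A *v b i = d i *\<^sub>R b i" for i j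
    using eb by (auto simp: eigenbasis_def)
  have "(\<Sum>v\<in>b ` I. (x \<bullet> v) *\<^sub>R v) = x"
    using x by (intro orthonormal_basis_expand) (auto simp: eigenbasis_independent[OF eb] norm_eq_1 b)
  then have x_eq: "x = (\<Sum>i\<in>I. (x \<bullet> b i) *\<^sub>R b i)"
    by (subst (asm) sum.reindex) (auto intro: inj_on_subset[OF eigenbasis_independent(1)[OF eb]])
  have "A *v x = (\<Sum>i\<in>I. (x \<bullet> b i) *\<^sub>R (A *v b i))"
    by (subst x_eq) (simp add: linear_sum[OF matrix_vector_mul_linear] matrix_vector_mult_scaleR)
  then show "x \<bullet> (A *v x) = (\<Sum>i\<in>I. d i * (x \<bullet> b i)\<^sup>2)"
    by (simp add: inner_sum_right Ab power2_eq_square mult_ac)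
  have "x \<bullet> x = x \<bullet> (\<Sum>i\<in>I. (x \<bullet> b i) *\<^sub>R b i)"
    using x_eq by simp
  then show "x \<bullet> x = (\<Sum>i\<in>I. (x \<bullet> b i)\<^sup>2)"
    by (simp add: inner_sum_right power2_eq_square)
qed

section \<open>Characteristic polynomial and ordered eigenvalues\<close>

lemma poly_charpoly: "poly (charpoly A) t = det (mat t - A)"
  unfolding charpoly_def det_def poly_sum
  by (intro sum.cong refl) (auto simp: poly_prod mat_def sign_def intro!: prod.cong)

text \<open>With the eigenvectors as columns of \<open>Q\<close>, \<open>mat t - A\<close> is
  conjugate to the diagonal matrix \<open>D\<close>. Orthonormality makes \<open>det Q\<close>
  nonzero, so it cancels from the determinants.\<close>

lemma charpoly_eigenbasis:
  fixes A :: "real^'n^'n"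
  assumes "eigenbasis A b d"
  shows "charpoly A = (\<Prod>i\<in>UNIV. [:- d i, 1:])"
proof -
  have b: "b i \<bullet> b j = (if i = j then 1 else 0)" and Ab: "A *v b i = d i *\<^sub>R b i" for i j
    using assms by (auto simp: eigenbasis_def)
  define Q :: "real^'n^'n" where "Q = (\<chi> i j. b j $ i)"
  have "transpose Q ** Q = mat 1"
    using b by (simp add: matrix_matrix_mult_def transpose_def Q_def mat_def vec_eq_iff inner_vec_def)
  then have "det (transpose Q) * det Q = 1"
    by (metis det_I det_mul)
  then have "det Q \<noteq> 0"
    by auto
  have "det (mat t - A) = (\<Prod>i\<in>UNIV. t - d i)" for t
  proof -
    define D :: "real^'n^'n" where "D = (\<chi> i j. if i = j then t - d i else 0)"
    have "((mat t - A) ** Q) $ i $ j = (Q ** D) $ i $ j" for i j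
    proof -
      have "((mat t - A) ** Q) $ i $ j = ((mat t - A) *v b j) $ i"
        by (simp add: matrix_matrix_mult_def matrix_vector_mult_def Q_def)
      also have "(mat t - A) *v b j = (t - d j) *\<^sub>R b j"
        by (simp add: matrix_vector_mult_diff_rdistrib mat_vector_mul Ab scaleR_diff_left)
      also have "((t - d j) *\<^sub>R b j) $ i = (Q ** D) $ i $ j"
        by (simp add: matrix_matrix_mult_def Q_def D_def if_distrib cong: if_cong)
      finally show ?thesis .
    qed
    then have "(mat t - A) ** Q = Q ** D"
      by (simp add: vec_eq_iff)
    then have "det (mat t - A) * det Q = det Q * det D"
      by (metis det_mul)
    moreover have "det D = (\<Prod>i\<in>UNIV. t - d i)"
      by (subst det_diagonal) (auto simp: D_def)
    ultimately show ?thesis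
      using \<open>det Q \<noteq> 0\<close> by simp
  qed
  then show ?thesis
    by (simp add: poly_eq_poly_eq_iff[symmetric] fun_eq_iff poly_charpoly poly_prod)
qed

lemma proots_prod_linear:
  fixes f :: "'i \<Rightarrow> 'a::idom"
  assumes "finite I"
  shows "proots (\<Prod>i\<in>I. [:- f i, 1:]) = image_mset f (mset_set I)"
  using assms by (subst proots_prod) (auto simp: sum_unfold_sum_mset)

lemma proots_charpoly_eigenbasis:
  "eigenbasis A b d \<Longrightarrow> proots (charpoly A) = image_mset d (mset_set UNIV)"
  by (simp add: charpoly_eigenbasis proots_prod_linear)

text \<open>This is how \<open>eigval\<close> and \<open>sigma_eigval\<close> are read off from a
  multiset of roots, given any increasing enumeration of it. Lists count from 0, hence
  \<open>k - 1\<close>.\<close>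

lemma sorted_list_of_image_mset_nth:
  fixes f :: "nat \<Rightarrow> 'a::linorder"
  assumes "mono_on {1..n} f" and "k \<in> {1..n}"
  shows "sorted_list_of_multiset (image_mset f (mset_set {1..n})) ! (k - 1) = f k"
proof -
  have "sorted (map f [1..<Suc n])"
    using assms(1) by (auto simp: sorted_iff_nth_mono monotone_on_def simp del: upt_Suc)
  moreover have "image_mset f (mset_set {1..n}) = mset (map f [1..<Suc n])"
    by (simp only: mset_map mset_upt atLeastLessThanSuc_atLeastAtMost)
  ultimately have "sorted_list_of_multiset (image_mset f (mset_set {1..n})) = map f [1..<Suc n]"
    by (simp only: sorted_list_of_multiset_mset sorted_sort_id)
  moreover have "map f [1..<Suc n] ! (k - 1) = f k"
    using assms(2) by (subst nth_map) (auto simp del: upt_Suc)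
  ultimately show ?thesis by simp
qed

lemma
  fixes A :: "real^'n^'n"
  assumes "A \<in> Sym2"
  shows eigval_mono: "mono_on {1..CARD('n)} (\<lambda>i. eigval i A)"
    and proots_charpoly: "proots (charpoly A) = image_mset (\<lambda>i. eigval i A) (mset_set {1..CARD('n)})"
proof -
  define xs where "xs = sorted_list_of_multiset (proots (charpoly A))"
  obtain b d where "eigenbasis A b d"
    using symmetric_eigenbasis_exists assms by blast
  then have "size (proots (charpoly A)) = CARD('n)"
    by (simp add: proots_charpoly_eigenbasis)
  moreover have mset_xs: "mset xs = proots (charpoly A)"
    by (simp add: xs_def)
  ultimately have len: "length xs = CARD('n)"
    by (metis size_mset)
  have "sorted xs"
    by (simp add: xs_def)
  then show "mono_on {1..CARD('n)} (\<lambda>i. eigval i A)"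
    using len by (auto simp: monotone_on_def eigval_def sorted_iff_nth_mono simp flip: xs_def)
  have "xs = map (\<lambda>i. eigval i A) [1..<Suc (CARD('n))]"
    by (rule nth_equalityI) (auto simp: len eigval_def simp flip: xs_def simp del: upt_Suc)
  then have "proots (charpoly A) = mset (map (\<lambda>i. eigval i A) [1..<Suc (CARD('n))])"
    using mset_xs by simp
  then show "proots (charpoly A) = image_mset (\<lambda>i. eigval i A) (mset_set {1..CARD('n)})"
    by (simp only: mset_map mset_upt atLeastLessThanSuc_atLeastAtMost)
qed

text \<open>All roots move under \<open>\<lambda>x. t * (x + s)\<close>, which is monotone because
  \<open>t \<ge> 0\<close>, so their ranks are kept.\<close>

lemma eigval_affine:
  fixes A :: "real^'n^'n"
  assumes A: "A \<in> Sym2" and "t \<ge> 0" and k: "k \<in> {1..CARD('n)}"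
  shows "eigval k (t *\<^sub>R (A + mat s)) = t * (eigval k A + s)"
proof -
  obtain b d where eb: "eigenbasis A b d"
    using symmetric_eigenbasis_exists A by blast
  have "proots (charpoly (t *\<^sub>R (A + mat s))) = image_mset (\<lambda>x. t * (x + s)) (proots (charpoly A))"
    by (simp add: proots_charpoly_eigenbasis[OF eb] proots_charpoly_eigenbasis[OF eigenbasis_affine[OF eb]]
        image_mset.compositionality comp_def)
  also have "\<dots> = image_mset (\<lambda>i. t * (eigval i A + s)) (mset_set {1..CARD('n)})"
    by (simp add: proots_charpoly[OF A] image_mset.compositionality comp_def)
  finally have "eigval k (t *\<^sub>R (A + mat s)) =
      sorted_list_of_multiset (image_mset (\<lambda>i. t * (eigval i A + s)) (mset_set {1..CARD('n)})) ! (k - 1)"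
    by (simp add: eigval_def)
  also have "\<dots> = t * (eigval k A + s)"
    using eigval_mono[OF A] \<open>t \<ge> 0\<close> k
    by (intro sorted_list_of_image_mset_nth) (auto simp: monotone_on_def mult_left_mono)
  finally show ?thesis .
qed

lemma eigval_add_mat:
  fixes A :: "real^'n^'n"
  assumes "A \<in> Sym2" and "k \<in> {1..CARD('n)}"
  shows "eigval k (A + mat s) = eigval k A + s"
  using eigval_affine[of A 1 k s] assms by simp

section \<open>Min-max comparison by counting eigenvalues\<close>

lemma card_eigval_le:
  fixes A :: "real^'n^'n"
  assumes "eigenbasis A b d" and A: "A \<in> Sym2"
  shows "card {i\<in>{1..CARD('n)}. eigval i A \<le> x} = card {i. d i \<le> x}"
proof -
  have *: "card {i\<in>I. f i \<le> x} = size (filter_mset (\<lambda>y. y \<le> x) (image_mset f (mset_set I)))"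
    if "finite I" for I :: "'k set" and f :: "'k \<Rightarrow> real"
    using that by (simp add: filter_mset_image_mset)
  show ?thesis
    using *[of "{1..CARD('n)}"] *[of "UNIV :: 'n set" d]
    by (simp flip: proots_charpoly[OF A] proots_charpoly_eigenbasis[OF assms(1)] del: One_nat_def)
qed

text \<open>Turns a bound on the \<open>k\<close>-th value into a count, which can be compared with
  dimensions of spans of eigenvectors.\<close>

lemma card_mono_le:
  fixes f :: "nat \<Rightarrow> real"
  assumes "mono_on {1..n} f" and "k \<in> {1..n}"
  shows "f k \<le> x \<longleftrightarrow> k \<le> card {i\<in>{1..n}. f i \<le> x}"
proof
  assume "f k \<le> x"
  have "f i \<le> f k" if "i \<in> {1..k}" for i
    using assms that by (auto simp: monotone_on_def)
  then have "{1..k} \<subseteq> {i\<in>{1..n}. f i \<le> x}"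
    using assms(2) \<open>f k \<le> x\<close> by force
  then have "card {1..k} \<le> card {i\<in>{1..n}. f i \<le> x}"
    by (intro card_mono) auto
  then show "k \<le> card {i\<in>{1..n}. f i \<le> x}"
    by simp
next
  assume le: "k \<le> card {i\<in>{1..n}. f i \<le> x}"
  show "f k \<le> x"
  proof (rule ccontr)
    assume nle: "\<not> f k \<le> x"
    have "f k \<le> f i" if "i \<in> {k..n}" for i
      using assms that by (auto simp: monotone_on_def)
    then have "\<not> f i \<le> x" if "i \<in> {k..n}" for i
      using nle that by fastforce
    then have "{i\<in>{1..n}. f i \<le> x} \<subseteq> {1..<k}"
      by (metis (no_types, lifting) atLeastAtMost_iff atLeastLessThan_iff mem_Collect_eq not_le subsetI)
    then have "card {i\<in>{1..n}. f i \<le> x} \<le> card {1..<k}"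
      by (intro card_mono) auto
    with le assms(2) show False
      by auto
  qed
qed

text \<open>The eigenvectors of \<open>A\<close> for eigenvalues above \<open>x\<close> and those of \<open>B\<close> for eigenvalues at most
  \<open>x\<close> span subspaces with trivial intersection, which bounds the sum of their dimensions.\<close>
lemma eigval_loewner_mono:
  fixes A B :: "real^'n^'n"
  assumes A: "A \<in> Sym2" and B: "B \<in> Sym2" and AB: "\<And>x. x \<bullet> (A *v x) \<le> x \<bullet> (B *v x)"
    and k: "k \<in> {1..CARD('n)}"
  shows "eigval k A \<le> eigval k B"
proof -
  define x where "x = eigval k B"
  obtain a c where a: "eigenbasis A a c"
    using symmetric_eigenbasis_exists A by blast
  obtain b d where b: "eigenbasis B b d"
    using symmetric_eigenbasis_exists B by blast
  define I where "I = {i. x < c i}"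
  define J where "J = {i. d i \<le> x}"
  have "v = 0" if v: "v \<in> span (a ` I)" "v \<in> span (b ` J)" for v
  proof -
    \<comment> \<open>The form of \<open>A - mat x\<close> is positive on nonzero vectors of the
      first span, that of \<open>B - mat x\<close> is nonpositive on the second, and the first form
      is bounded by the second. Hence all coefficients of \<open>v\<close> vanish.\<close>
    have "(\<Sum>i\<in>I. (c i - x) * (v \<bullet> a i)\<^sup>2) = v \<bullet> (A *v v) - x * (v \<bullet> v)"
      by (simp add: eigenbasis_span_quadratic_form[OF a v(1)] left_diff_distrib sum_subtractf sum_distrib_left)
    also have "\<dots> \<le> v \<bullet> (B *v v) - x * (v \<bullet> v)"
      using AB by simp
    also have "\<dots> = (\<Sum>i\<in>J. (d i - x) * (v \<bullet> b i)\<^sup>2)"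
      by (simp add: eigenbasis_span_quadratic_form[OF b v(2)] left_diff_distrib sum_subtractf sum_distrib_left)
    also have "\<dots> \<le> 0"
      by (intro sum_nonpos) (auto simp: J_def mult_nonpos_nonneg)
    finally have "(\<Sum>i\<in>I. (c i - x) * (v \<bullet> a i)\<^sup>2) \<le> 0" .
    moreover have nonneg: "0 \<le> (c i - x) * (v \<bullet> a i)\<^sup>2" if "i \<in> I" for i
      using that by (simp add: I_def)
    ultimately have "(\<Sum>i\<in>I. (c i - x) * (v \<bullet> a i)\<^sup>2) = 0"
      by (meson antisym sum_nonneg)
    then have "\<forall>i\<in>I. (c i - x) * (v \<bullet> a i)\<^sup>2 = 0"
      using nonneg by (subst (asm) sum_nonneg_eq_0_iff) auto
    then have "\<forall>i\<in>I. (v \<bullet> a i)\<^sup>2 = 0"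
      by (auto simp: I_def)
    then have "v \<bullet> v = 0"
      by (simp add: eigenbasis_span_quadratic_form(2)[OF a v(1)])
    then show "v = 0" by simp
  qed
  then have "span (a ` I) \<inter> span (b ` J) = {0}"
    by (auto simp: span_zero)
  then have "dim (span (a ` I)) + dim (span (b ` J)) \<le> CARD('n)"
    using dim_sums_Int[of "span (a ` I)" "span (b ` J)"]
      dim_subset_UNIV[of "{y + z |y z. y \<in> span (a ` I) \<and> z \<in> span (b ` J)}"] by auto
  then have "card I + card J \<le> CARD('n)"
    by (simp only: eigenbasis_independent(4)[OF a] eigenbasis_independent(4)[OF b])
  moreover have "card {i. c i \<le> x} + card I = CARD('n)"
  proof -
    have "{i. c i \<le> x} = UNIV - I"
      by (auto simp: I_def)
    then show ?thesis
      by (simp add: card_Diff_subset card_mono)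
  qed
  \<comment> \<open>\<open>I\<close> is the complement of the indices with
    \<open>c i \<le> x\<close>, so the dimension bound says that at least as many eigenvalues of
    \<open>A\<close> as of \<open>B\<close> are at most \<open>x\<close>.\<close>
  ultimately have "card {i\<in>{1..CARD('n)}. eigval i B \<le> x} \<le> card {i\<in>{1..CARD('n)}. eigval i A \<le> x}"
    using card_eigval_le[OF a A] card_eigval_le[OF b B] by (simp add: J_def)
  moreover have "k \<le> card {i\<in>{1..CARD('n)}. eigval i B \<le> x}"
    using card_mono_le[OF eigval_mono[OF B] k, of x] by (simp add: x_def)
  ultimately show ?thesis
    using card_mono_le[OF eigval_mono[OF A] k, of x] by (simp add: x_def)
qed

subsection \<open>Interiors and closures of Loewner monotone sets\<close>

text \<open>Every entry of \<open>A - B\<close> is bounded by its norm, so its operator norm is at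
  most the squared dimension times that norm. Norm balls are thereby compared with shifts by
  multiples of the identity.\<close>

lemma loewner_near:
  fixes A B :: "real^'n^'n"
  assumes "norm (A - B) * (real CARD('n))\<^sup>2 \<le> e"
  shows "x \<bullet> (A *v x) \<le> x \<bullet> ((B + mat e) *v x)"
proof -
  have "\<bar>(A - B) $ i $ j\<bar> \<le> norm (A - B)" for i j
    by (meson Finite_Cartesian_Product.norm_nth_le component_le_norm_cart order_trans)
  then have "onorm ((*v) (A - B)) \<le> real CARD('n) * real CARD('n) * norm (A - B)"
    by (rule onorm_le_matrix_component)
  also have "\<dots> \<le> e"
    using assms by (simp add: power2_eq_square mult_ac)
  finally have "onorm ((*v) (A - B)) \<le> e" .
  then have "norm ((A - B) *v x) \<le> e * norm x"
    by (meson matrix_vector_mul_bounded_linear mult_right_mono norm_ge_zero onorm order_trans)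
  then have "x \<bullet> ((A - B) *v x) \<le> norm x * (e * norm x)"
    by (meson mult_left_mono norm_cauchy_schwarz norm_ge_zero order_trans)
  also have "\<dots> = e * (x \<bullet> x)"
    by (simp add: dot_square_norm power2_eq_square)
  finally show ?thesis
    by (simp add: matrix_vector_mult_diff_rdistrib matrix_vector_mult_add_rdistrib mat_vector_mul
        inner_diff_right inner_add_right)
qed

lemma openin_Sym2:
  "openin (top_of_set Sym2) U \<longleftrightarrow> U \<subseteq> Sym2 \<and> (\<forall>A\<in>U. \<exists>e>0. \<forall>B\<in>Sym2. dist B A < e \<longrightarrow> B \<in> U)"
  by (auto simp: openin_euclidean_subtopology_iff)

text \<open>By the first part, the set in the second part is the closure of \<open>U\<close>. It is
  spelled out because \<open>Lam k\<close> and \<open>sigma_Lam k\<close> take this form directly,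
  by the shift rules of their eigenvalues.\<close>

lemma
  fixes U :: "(real^'n^'n) set"
  assumes sub: "U \<subseteq> Sym2"
    and mono: "\<And>A B. A \<in> U \<Longrightarrow> B \<in> Sym2 \<Longrightarrow> (\<And>x. x \<bullet> (A *v x) \<le> x \<bullet> (B *v x)) \<Longrightarrow> B \<in> U"
    and shrink: "\<And>A. A \<in> U \<Longrightarrow> \<exists>e>0. A - mat e \<in> U"
  shows Cl_Sym_monotone: "Cl_Sym U = {A \<in> Sym2. \<forall>s>0. A + mat s \<in> U}" (is "_ = ?C")
    and Int_Sym_monotone: "Int_Sym {A \<in> Sym2. \<forall>s>0. A + mat s \<in> U} = U"
proof -
  let ?K = "(real CARD('n))\<^sup>2"
  have K: "?K > 0" by simp
  have U_near: "B + mat e \<in> U" if "A \<in> U" "B \<in> Sym2" "dist A B < e / ?K" for A B e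
  proof (rule mono[OF that(1)])
    show "x \<bullet> (A *v x) \<le> x \<bullet> ((B + mat e) *v x)" for x
      using that(3) by (intro loewner_near) (simp add: dist_norm field_simps)
  qed (simp add: Sym2_add_mat that)
  have mat_near: "\<exists>s>0. norm (mat s :: real^'n^'n) < e" if "e > 0" for e :: real
  proof (intro exI conjI)
    let ?N = "norm (mat 1 :: real^'n^'n)"
    have eq: "(mat s :: real^'n^'n) = s *\<^sub>R mat 1" for s
      by (simp add: mat_def vec_eq_iff)
    show "e / (?N + 1) > 0"
      using that by (simp add: add_nonneg_pos)
    have "e / (?N + 1) * ?N < e"
      using that mult_strict_left_mono[of ?N "?N + 1" e] by (subst times_divide_eq_left, subst pos_divide_less_eq) (auto simp: add_nonneg_pos)
    then show "norm (mat (e / (?N + 1)) :: real^'n^'n) < e"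
      using that by (subst eq) (simp add: add_nonneg_nonneg)
  qed
  show "Cl_Sym U = ?C"
  proof (intro set_eqI iffI)
    fix A assume A: "A \<in> Cl_Sym U"
    then have "A \<in> Sym2"
      by (simp add: Cl_Sym_def in_closure_of)
    moreover have "A + mat s \<in> U" if "s > 0" for s
    proof -
      have "openin (top_of_set Sym2) (Sym2 \<inter> ball A (s / ?K))"
        by (simp add: openin_open_Int)
      moreover have "A \<in> Sym2 \<inter> ball A (s / ?K)"
        using \<open>A \<in> Sym2\<close> \<open>s > 0\<close> by simp
      ultimately obtain B where "B \<in> U" "B \<in> ball A (s / ?K)"
        using A unfolding Cl_Sym_def in_closure_of by blast
      then show ?thesis
        using U_near[of B A s] \<open>A \<in> Sym2\<close> by (simp add: dist_commute)
    qed
    ultimately show "A \<in> ?C" by simp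
  next
    fix A assume A: "A \<in> ?C"
    have "\<exists>y. y \<in> U \<and> y \<in> T" if T: "A \<in> T" "openin (top_of_set Sym2) T" for T
    proof -
      obtain e where e: "e > 0" "\<And>B. B \<in> Sym2 \<Longrightarrow> dist B A < e \<Longrightarrow> B \<in> T"
        using T unfolding openin_Sym2 by blast
      obtain s where s: "s > 0" "norm (mat s :: real^'n^'n) < e"
        using mat_near[OF e(1)] by blast
      then have "A + mat s \<in> U \<and> A + mat s \<in> T"
        using A e(2)[of "A + mat s"] by (simp add: Sym2_add_mat dist_norm)
      then show ?thesis by blast
    qed
    then show "A \<in> Cl_Sym U"
      using A by (auto simp: Cl_Sym_def in_closure_of)
  qed
  show "Int_Sym ?C = U"
  proof
    have "openin (top_of_set Sym2) U"
      unfolding openin_Sym2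
    proof (intro conjI ballI sub)
      fix A assume "A \<in> U"
      then obtain e where e: "e > 0" "A - mat e \<in> U"
        using shrink by blast
      \<comment> \<open>\<open>A - mat e\<close> still lies in \<open>U\<close>, and
        \<open>B - mat e\<close> is as far from it as \<open>B\<close> is from \<open>A\<close>; one
        shift by \<open>e\<close> then brings \<open>B\<close> into \<open>U\<close>.\<close>
      have "B \<in> U" if "B \<in> Sym2" "dist B A < e / ?K" for B
        using U_near[of "A - mat e" "B - mat e" e] e that by (simp add: Sym2_diff_mat dist_norm norm_minus_commute)
      then show "\<exists>d>0. \<forall>B\<in>Sym2. dist B A < d \<longrightarrow> B \<in> U"
        using e(1) K by (metis divide_pos_pos)
    qed
    moreover have "U \<subseteq> ?C"
    proof clarify
      fix A assume A: "A \<in> U"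
      then have "A \<in> Sym2" using sub by auto
      moreover have "A + mat s \<in> U" if "s > 0" for s
        using A \<open>A \<in> Sym2\<close> that by (intro U_near[of A]) auto
      ultimately show "A \<in> Sym2 \<and> (\<forall>s>0. A + mat s \<in> U)" by simp
    qed
    ultimately show "U \<subseteq> Int_Sym ?C"
      unfolding Int_Sym_def by (simp add: interior_of_maximal)
  next
    show "Int_Sym ?C \<subseteq> U"
    proof
      fix A assume A: "A \<in> Int_Sym ?C"
      have "openin (top_of_set Sym2) (Int_Sym ?C)"
        by (simp add: Int_Sym_def)
      then obtain e where e: "e > 0" "\<And>B. B \<in> Sym2 \<Longrightarrow> dist B A < e \<Longrightarrow> B \<in> Int_Sym ?C"
          and "A \<in> Sym2"
        using A unfolding openin_Sym2 by blast
      obtain s where s: "s > 0" "norm (mat s :: real^'n^'n) < e"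
        using mat_near[OF e(1)] by blast
      have "A - mat s \<in> ?C"
        using s(2) e(2)[of "A - mat s"] \<open>A \<in> Sym2\<close> interior_of_subset
        by (force simp: Sym2_diff_mat dist_norm Int_Sym_def)
      then have "A - mat s + mat s \<in> U"
        using s(1) by blast
      then show "A \<in> U" by simp
    qed
  qed
qed

lemma nonneg_iff_add_pos: "0 \<le> x \<longleftrightarrow> (\<forall>s>0. 0 < x + s)" for x :: real
  by (metis add.right_inverse add_nonneg_pos less_irrefl neg_0_less_iff_less not_le)

text \<open>Eigenvalues shift with the matrix, so nonnegativity of the \<open>k\<close>-th one means
  positivity after every positive shift. This is the shape that \<open>Int_Sym_monotone\<close>
  handles.\<close>

lemma Int_Sym_Lam:
  assumes k: "k \<in> {1..CARD('n)}"
  shows "Int_Sym (Lam k :: (real^'n^'n) set) = {A \<in> Sym2. eigval k A > 0}"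
proof -
  define U where "U = {A :: real^'n^'n. A \<in> Sym2 \<and> eigval k A > 0}"
  have "Lam k = {A \<in> Sym2. \<forall>s>0. A + mat s \<in> U}"
    using k nonneg_iff_add_pos by (auto simp: Lam_def U_def Sym2_add_mat eigval_add_mat)
  moreover have "Int_Sym {A \<in> Sym2. \<forall>s>0. A + mat s \<in> U} = U"
  proof (rule Int_Sym_monotone)
    show "U \<subseteq> Sym2" by (auto simp: U_def)
    show "B \<in> U" if "A \<in> U" "B \<in> Sym2" "\<And>x. x \<bullet> (A *v x) \<le> x \<bullet> (B *v x)" for A B
      using that eigval_loewner_mono[of A B k] k by (auto simp: U_def)
    show "\<exists>e>0. A - mat e \<in> U" if "A \<in> U" for A
      using that k by (intro exI[of _ "eigval k A / 2"])
        (auto simp: U_def diff_mat Sym2_add_mat eigval_add_mat)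
  qed
  ultimately show ?thesis by (simp add: U_def)
qed

section \<open>The asymptotic interior as a condition at infinity\<close>

lemma tr_arctan_affine:
  fixes A :: "real^'n^'n"
  assumes "A \<in> Sym2" "t \<ge> 0"
  shows "tr_arctan (t *\<^sub>R (A - mat e)) = (\<Sum>i = 1..CARD('n). arctan (t * (eigval i A - e)))"
  using assms by (simp add: tr_arctan_def diff_mat eigval_affine)

text \<open>Membership becomes an eventual statement in \<open>t\<close>, so that limits can decide
  it. Restricting to \<open>t \<ge> 0\<close> keeps the eigenvalues of the scaled matrix in
  order.\<close>

lemma asymp_interior_F_arctan:
  fixes A :: "real^'n^'n"
  assumes "A \<in> Sym2"
  shows "A \<in> asymp_interior (F_arctan \<theta>) \<longleftrightarrow>
    (\<exists>e>0. \<forall>\<^sub>F t in at_top. \<theta> \<le> (\<Sum>i = 1..CARD('n). arctan (t * (eigval i A - e))))"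
proof -
  have "(\<exists>t0. \<forall>t\<ge>t0. t *\<^sub>R (A - mat e) \<in> F_arctan \<theta>) \<longleftrightarrow>
      (\<forall>\<^sub>F t in at_top. \<theta> \<le> (\<Sum>i = 1..CARD('n). arctan (t * (eigval i A - e))))" for e
    unfolding eventually_at_top_linorder[symmetric]
    using assms by (intro eventually_subst eventually_mono[OF eventually_ge_at_top[of 0]])
      (simp add: F_arctan_def Sym2_scaleR Sym2_diff_mat tr_arctan_affine)
  then show ?thesis
    using assms by (simp add: asymp_interior_def)
qed

text \<open>The second part serves \<open>sigma_Lam k\<close>: once \<open>U\<close> is known to be
  where \<open>sigma_eigval k\<close> is positive, Loewner monotonicity is inherited from
  \<open>F_arctan\<close>.\<close>

lemma Int_Sym_asymp_subeq_F_arctan: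
  fixes \<theta> :: real
  defines "U \<equiv> asymp_interior (F_arctan \<theta>) :: (real^'n^'n) set"
  shows "Int_Sym (asymp_subeq (F_arctan \<theta>)) = U"
    and "Int_Sym {A \<in> Sym2. \<forall>s>0. A + mat s \<in> U} = U"
proof -
  have sub: "U \<subseteq> Sym2"
    by (auto simp: U_def asymp_interior_def)
  have mono: "B \<in> U" if A: "A \<in> U" and B: "B \<in> Sym2" and le: "\<And>x. x \<bullet> (A *v x) \<le> x \<bullet> (B *v x)" for A B
  proof -
    have "A \<in> Sym2" using A sub by auto
    then obtain e where e: "e > 0"
        "\<forall>\<^sub>F t in at_top. \<theta> \<le> (\<Sum>i = 1..CARD('n). arctan (t * (eigval i A - e)))"
      using A asymp_interior_F_arctan unfolding U_def by blast
    have "\<forall>\<^sub>F t in at_top. \<theta> \<le> (\<Sum>i = 1..CARD('n). arctan (t * (eigval i B - e)))"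
      using e(2) eventually_ge_at_top[of 0]
    proof eventually_elim
      case (elim t)
      have "(\<Sum>i = 1..CARD('n). arctan (t * (eigval i A - e))) \<le>
          (\<Sum>i = 1..CARD('n). arctan (t * (eigval i B - e)))"
        using eigval_loewner_mono[OF \<open>A \<in> Sym2\<close> B le] elim(2)
        by (intro sum_mono) (auto simp: arctan_le_iff intro!: mult_left_mono)
      with elim(1) show ?case by simp
    qed
    then show ?thesis
      using e(1) asymp_interior_F_arctan[OF B] by (auto simp: U_def)
  qed
  have shrink: "\<exists>e>0. A - mat e \<in> U" if A: "A \<in> U" for A
  proof -
    obtain e t0 where e: "e > 0" "\<And>t. t \<ge> t0 \<Longrightarrow> t *\<^sub>R (A - mat e) \<in> F_arctan \<theta>"
      using A unfolding U_def asymp_interior_def by blast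
    have eq: "A - mat (e / 2) - mat (e / 2) = A - mat e"
      by (simp add: vec_eq_iff mat_def)
    show ?thesis
      using A e sub
      by (auto simp: U_def asymp_interior_def Sym2_diff_mat eq
          intro!: exI[of _ "e / 2"] exI[of "\<lambda>t0. \<forall>t\<ge>t0. _ t" t0])
  qed
  show *: "Int_Sym {A \<in> Sym2. \<forall>s>0. A + mat s \<in> U} = U"
    by (rule Int_Sym_monotone[OF sub mono shrink])
  show "Int_Sym (asymp_subeq (F_arctan \<theta>)) = U"
    using Cl_Sym_monotone[OF sub mono shrink] * by (simp add: asymp_subeq_def flip: U_def)
qed

subsection \<open>Sums of arctangents at infinity\<close>

lemma tendsto_sum_arctan:
  fixes f :: "'i \<Rightarrow> real"
  shows "((\<lambda>t. \<Sum>i\<in>I. arctan (t * f i)) \<longlongrightarrow> (\<Sum>i\<in>I. sgn (f i)) * (pi / 2)) at_top"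
  unfolding sum_distrib_right
proof (rule tendsto_sum)
  fix i
  consider "f i > 0" | "f i = 0" | "f i < 0" by linarith
  then show "((\<lambda>t. arctan (t * f i)) \<longlongrightarrow> sgn (f i) * (pi / 2)) at_top"
    by cases (simp_all, real_asymp+)
qed

lemma sum_arctan_reciprocal:
  fixes f :: "'i \<Rightarrow> real"
  assumes "t > 0" "\<And>i. i \<in> I \<Longrightarrow> f i \<noteq> 0"
  shows "(\<Sum>i\<in>I. arctan (t * f i)) = (\<Sum>i\<in>I. sgn (f i)) * (pi / 2) - (\<Sum>i\<in>I. arctan (1 / (t * f i)))"
  unfolding sum_distrib_right sum_subtractf[symmetric]
  using assms by (intro sum.cong refl, subst Transcendental.arctan_inverse) (auto simp: sgn_mult)

lemma tendsto_sum_arctan_reciprocal: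
  fixes f :: "'i \<Rightarrow> real"
  assumes "\<And>i. i \<in> I \<Longrightarrow> f i \<noteq> 0"
  shows "((\<lambda>t. t * (\<Sum>i\<in>I. arctan (1 / (t * f i)))) \<longlongrightarrow> (\<Sum>i\<in>I. 1 / f i)) at_top"
  unfolding sum_distrib_left
proof (rule tendsto_sum)
  fix i assume "i \<in> I"
  then consider "f i > 0" | "f i < 0" using assms[of i] by linarith
  then show "((\<lambda>t. t * arctan (1 / (t * f i))) \<longlongrightarrow> 1 / f i) at_top"
    by cases (real_asymp simp: field_simps)+
qed

text \<open>At the critical phase the sign of the next term in the expansion of the arctangents at
  infinity decides.\<close>
lemma eventually_critical_sum_arctan:
  fixes f :: "'i \<Rightarrow> real"
  assumes nz: "\<And>i. i \<in> I \<Longrightarrow> f i \<noteq> 0" and \<theta>: "\<theta> = (\<Sum>i\<in>I. sgn (f i)) * (pi / 2)"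
  shows "(\<Sum>i\<in>I. 1 / f i) < 0 \<Longrightarrow> \<forall>\<^sub>F t in at_top. \<theta> \<le> (\<Sum>i\<in>I. arctan (t * f i))"
    and "(\<Sum>i\<in>I. 1 / f i) > 0 \<Longrightarrow> \<forall>\<^sub>F t in at_top. (\<Sum>i\<in>I. arctan (t * f i)) < \<theta>"
proof -
  have lim: "((\<lambda>t. t * (\<Sum>i\<in>I. arctan (1 / (t * f i)))) \<longlongrightarrow> (\<Sum>i\<in>I. 1 / f i)) at_top"
    by (rule tendsto_sum_arctan_reciprocal) (rule nz)
  have iff: "(\<Sum>i\<in>I. arctan (t * f i)) = \<theta> - (\<Sum>i\<in>I. arctan (1 / (t * f i)))" if "t > 0" for t
    unfolding \<theta> by (rule sum_arctan_reciprocal[OF that]) (rule nz)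
  { assume "(\<Sum>i\<in>I. 1 / f i) < 0"
    from order_tendstoD(2)[OF lim this] eventually_gt_at_top[of 0]
    show "\<forall>\<^sub>F t in at_top. \<theta> \<le> (\<Sum>i\<in>I. arctan (t * f i))"
      by eventually_elim (simp add: iff mult_less_0_iff) }
  { assume "(\<Sum>i\<in>I. 1 / f i) > 0"
    from order_tendstoD(1)[OF lim this] eventually_gt_at_top[of 0]
    show "\<forall>\<^sub>F t in at_top. (\<Sum>i\<in>I. arctan (t * f i)) < \<theta>"
      by eventually_elim (simp add: iff zero_less_mult_iff) }
qed

lemma sum_split_at:
  fixes g :: "nat \<Rightarrow> real"
  assumes "m \<le> n"
  shows "sum g {1..n} = sum g {1..m} + sum g {m+1..n}"
  using assms sum.ub_add_nat[of 1 m g "n - m"] by simp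

text \<open>The first \<open>k\<close> signs are -1 and the others at most 1. This bound and that of
  \<open>sum_sgn_ge\<close> are, in units of \<open>pi / 2\<close>, the ends of the
  \<open>k\<close>-th phase interval.\<close>

lemma sum_sgn_le:
  fixes f :: "nat \<Rightarrow> real"
  assumes "mono_on {1..n} f" "k \<in> {1..n}" "f k < 0"
  shows "(\<Sum>i = 1..n. sgn (f i)) \<le> real n - 2 * real k"
proof -
  have "f i < 0" if "i \<in> {1..k}" for i
    using assms that by (intro le_less_trans[OF _ assms(3)]) (auto simp: monotone_on_def)
  then have "(\<Sum>i = 1..k. sgn (f i)) = - real k"
    by simp
  moreover have "(\<Sum>i = k+1..n. sgn (f i)) \<le> (\<Sum>i = k+1..n. 1)"
    by (intro sum_mono) (simp add: sgn_if)
  ultimately show ?thesis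
    using assms(2) sum_split_at[of k n "\<lambda>i. sgn (f i)"] by (simp add: of_nat_diff)
qed

lemma sum_sgn_ge:
  fixes f :: "nat \<Rightarrow> real"
  assumes "mono_on {1..n} f" "k \<in> {1..n}" "f k > 0"
  shows "(\<Sum>i = 1..n. sgn (f i)) \<ge> real n - 2 * (real k - 1)"
proof -
  have "f i > 0" if "i \<in> {k..n}" for i
    using assms that by (intro less_le_trans[OF assms(3)]) (auto simp: monotone_on_def)
  then have "(\<Sum>i = k..n. sgn (f i)) = real (n + 1 - k)"
    by simp
  moreover have "(\<Sum>i = 1..k-1. sgn (f i)) \<ge> (\<Sum>i = 1..k-1. -1)"
    by (intro sum_mono) (simp add: sgn_if)
  ultimately show ?thesis
    using assms(2) sum_split_at[of "k-1" n "\<lambda>i. sgn (f i)"] by (auto simp: of_nat_diff)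
qed

subsection \<open>Interlacing roots of the derivative\<close>

lemma count_image_mset_set:
  "finite I \<Longrightarrow> count (image_mset f (mset_set I)) x = card {i\<in>I. f i = x}"
  by (simp add: count_image_mset vimage_def Int_def conj_commute)

lemma order_prod_linear:
  fixes f :: "'i \<Rightarrow> 'a::idom"
  assumes "finite I"
  shows "order x (\<Prod>i\<in>I. [:f i, 1:]) = card {i\<in>I. f i = - x}"
proof -
  have "(\<Prod>i\<in>I. [:f i, 1:]) \<noteq> 0"
    using assms by simp
  then have "order x (\<Prod>i\<in>I. [:f i, 1:]) = count (proots (\<Prod>i\<in>I. [:- (- f i), 1:])) x"
    by simp
  also have "\<dots> = card {i\<in>I. - f i = x}"
    unfolding proots_prod_linear[OF assms] count_image_mset_set[OF assms] ..
  also have "{i\<in>I. - f i = x} = {i\<in>I. f i = - x}"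
    by (auto simp: minus_equation_iff)
  finally show ?thesis .
qed

text \<open>The logarithmic derivative: for \<open>g i = f i + x\<close> the left side is the
  derivative of the product at \<open>x\<close>, by \<open>poly_pderiv_prod_linear\<close>.\<close>

lemma sum_prod_remove:
  fixes g :: "'i \<Rightarrow> 'a::field"
  assumes "finite I" "\<And>i. i \<in> I \<Longrightarrow> g i \<noteq> 0"
  shows "(\<Sum>i\<in>I. \<Prod>j\<in>I - {i}. g j) = (\<Prod>i\<in>I. g i) * (\<Sum>i\<in>I. 1 / g i)"
  unfolding sum_distrib_left
  using assms by (intro sum.cong refl) (simp add: prod_diff1)

lemma poly_pderiv_prod_linear:
  fixes f :: "'i \<Rightarrow> 'a::idom"
  shows "poly (pderiv (\<Prod>i\<in>I. [:f i, 1:])) x = (\<Sum>i\<in>I. \<Prod>j\<in>I - {i}. f j + x)"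
  by (simp add: pderiv_prod poly_sum poly_prod pderiv_pCons)

text \<open>For increasing \<open>f\<close> this says that \<open>- m\<close> is the root of the derivative of \<open>\<Prod> (x + f j)\<close> attached to
  the gap between \<open>f i\<close> and \<open>f (i + 1)\<close>; the reciprocal sum makes the condition invariant under
  shifts.\<close>
definition interlacing_critical :: "nat \<Rightarrow> (nat \<Rightarrow> real) \<Rightarrow> nat \<Rightarrow> real \<Rightarrow> bool" where
  "interlacing_critical n f i m \<longleftrightarrow>
    f i = f (i + 1) \<and> m = f i \<or>
    f i < m \<and> m < f (i + 1) \<and> (\<Sum>j = 1..n. 1 / (f j - m)) = 0"

lemma gap_avoids_values:
  fixes f :: "nat \<Rightarrow> real"
  assumes "mono_on {1..n} f" "i \<in> {1..n - 1}" "f i < x" "x < f (i + 1)" "j \<in> {1..n}"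
  shows "j \<le> i \<Longrightarrow> f j < x" and "i < j \<Longrightarrow> x < f j" and "f j \<noteq> x"
proof -
  show 1: "f j < x" if "j \<le> i"
    using assms that by (intro le_less_trans[OF _ assms(3)]) (auto simp: monotone_on_def)
  show 2: "x < f j" if "i < j"
    using assms that by (intro less_le_trans[OF assms(4)]) (auto simp: monotone_on_def)
  show "f j \<noteq> x"
    using 1 2 by (cases "j \<le> i") auto
qed

text \<open>Equal neighbours are immediate. Otherwise the mean value theorem gives a zero of the
  derivative between the roots \<open>- f (i + 1)\<close> and \<open>- f i\<close>; no factor
  vanishes there, so the reciprocal sum does.\<close>

lemma interlacing_critical_exists:
  fixes f :: "nat \<Rightarrow> real"
  assumes f: "mono_on {1..n} f" and i: "i \<in> {1..n - 1}"
  shows "\<exists>m. interlacing_critical n f i m"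
proof (cases "f i = f (i + 1)")
  case False
  define P where "P = (\<Prod>j\<in>{1..n}. [:f j, 1:])"
  have "f i < f (i + 1)"
    using False f i by (auto simp: monotone_on_def less_le)
  then obtain x where x: "- f (i + 1) < x" "x < - f i"
      "poly P (- f i) - poly P (- f (i + 1)) = (- f i - - f (i + 1)) * poly (pderiv P) x"
    using poly_MVT[of "- f (i + 1)" "- f i" P] by auto
  moreover have "poly P (- f j) = 0" if "j \<in> {1..n}" for j
    using that by (auto simp: P_def poly_prod)
  ultimately have "poly (pderiv P) x = 0"
    using i \<open>f i < f (i + 1)\<close> by auto
  moreover have nz: "f j + x \<noteq> 0" if "j \<in> {1..n}" for j
    using gap_avoids_values(3)[OF f i, of "- x" j] x that by auto
  ultimately have "(\<Prod>j = 1..n. f j + x) * (\<Sum>j = 1..n. 1 / (f j + x)) = 0"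
    using sum_prod_remove[of "{1..n}" "\<lambda>j. f j + x"] by (simp add: P_def poly_pderiv_prod_linear)
  then have "(\<Sum>j = 1..n. 1 / (f j + x)) = 0"
    using nz by simp
  then show ?thesis
    using x by (intro exI[of _ "- x"]) (auto simp: interlacing_critical_def)
qed (auto simp: interlacing_critical_def)

lemma interlacing_critical_bounds:
  "interlacing_critical n f i m \<Longrightarrow> f i \<le> m \<and> m \<le> f (i + 1)"
  by (auto simp: interlacing_critical_def)

text \<open>If \<open>f\<close> takes the value \<open>y\<close> exactly \<open>e\<close> times, at
  most \<open>e - 1\<close> critical values equal \<open>y\<close>, and the derivative loses just
  one order at the root \<open>- y\<close>. Otherwise \<open>y\<close> lies in at most one gap, and
  it suffices that \<open>- y\<close> is a root of the derivative.\<close>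

lemma interlacing_critical_count_le:
  fixes f \<mu> :: "nat \<Rightarrow> real"
  assumes f: "mono_on {1..n} f" and \<mu>: "\<And>i. i \<in> {1..n - 1} \<Longrightarrow> interlacing_critical n f i (\<mu> i)"
    and "n > 0"
  shows "card {i\<in>{1..n - 1}. \<mu> i = y} \<le> order (- y) (pderiv (\<Prod>j\<in>{1..n}. [:f j, 1:]))"
proof -
  define P where "P = (\<Prod>j\<in>{1..n}. [:f j, 1:])"
  have "degree P = n"
    by (simp add: P_def degree_prod_sum_eq)
  with \<open>n > 0\<close> have P0: "P \<noteq> 0" "pderiv P \<noteq> 0"
    by (auto simp: pderiv_eq_0_iff)
  let ?M = "{i\<in>{1..n - 1}. \<mu> i = y}"
  show ?thesis
  proof (cases "\<exists>j\<in>{1..n}. f j = y")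
    case True
    then obtain j where j: "j \<in> {1..n}" "f j = y" by blast
    let ?E = "{j\<in>{1..n}. f j = y}"
    have eq: "f i = y \<and> f (i + 1) = y" if "i \<in> ?M" for i
      using \<mu>[of i] that j gap_avoids_values(3)[OF f, of i y j] unfolding interlacing_critical_def by auto
    \<comment> \<open>For such an index both \<open>i\<close> and \<open>Suc i\<close> lie in
      \<open>?E\<close>; passing to \<open>Suc i\<close> misses the least element, which accounts
      for the drop by one.\<close>
    have "Suc ` ?M \<subseteq> ?E - {Min ?E}"
    proof
      fix l assume "l \<in> Suc ` ?M"
      then obtain i where i: "i \<in> ?M" "l = Suc i" by blast
      then have *: "i \<in> ?E" "Suc i \<in> ?E"
        using eq[of i] by auto
      have "Min ?E \<le> i"
        using *(1) by (intro Min_le) auto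
      then have "Suc i \<noteq> Min ?E"
        by linarith
      then show "l \<in> ?E - {Min ?E}"
        unfolding i(2) using *(2) by blast
    qed
    then have "card (Suc ` ?M) \<le> card (?E - {Min ?E})"
      by (intro card_mono) auto
    also have "Min ?E \<in> ?E"
      using True by (intro Min_in) auto
    then have "card (?E - {Min ?E}) = card ?E - 1"
      by (intro card_Diff_singleton)
    also have "card (Suc ` ?M) = card ?M"
      by (simp add: card_image)
    finally have "card ?M \<le> card ?E - 1" .
    moreover have "order (- y) P = card ?E"
      by (simp add: P_def order_prod_linear)
    moreover have "poly P (- y) = 0"
      using True by (auto simp: P_def poly_prod)
    ultimately show ?thesis
      using order_pderiv[OF P0(1), of "- y"] by (simp del: One_nat_def flip: P_def)
  next
    case False
    have gap: "f i < y \<and> y < f (i + 1) \<and> (\<Sum>j = 1..n. 1 / (f j - y)) = 0" if "i \<in> ?M" for i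
      using \<mu>[of i] that False unfolding interlacing_critical_def by auto
    have "\<not> i < i'" if "i \<in> ?M" "i' \<in> ?M" for i i'
    proof
      assume "i < i'"
      moreover have "i \<in> {1..n - 1}" "i' \<in> {1..n}"
        using that by auto
      ultimately have "y < f i'"
        using gap[OF that(1)] gap_avoids_values(2)[OF f, of i y i'] by blast
      then show False
        using gap[OF that(2)] by linarith
    qed
    then have unique: "i = i'" if "i \<in> ?M" "i' \<in> ?M" for i i'
      using that by (meson linorder_neqE_nat)
    show ?thesis
    proof (cases "?M = {}")
      case True
      then show ?thesis by (simp only: card.empty)
    next
      case nonempty: False
      then obtain i where i: "i \<in> ?M" by blast
      then have "?M = {i}"
        using unique by blast
      then have "card ?M = 1" by simp
      moreover have "poly (pderiv P) (- y) = (\<Prod>j = 1..n. f j - y) * (\<Sum>j = 1..n. 1 / (f j - y))"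
        using sum_prod_remove[of "{1..n}" "\<lambda>j. f j - y"] False
        by (simp add: P_def poly_pderiv_prod_linear)
      then have "poly (pderiv P) (- y) = 0"
        using gap[OF i] by simp
      then have "order (- y) (pderiv P) \<noteq> 0"
        using P0(2) by (simp add: order_root)
      ultimately show ?thesis
        by (simp del: One_nat_def flip: P_def)
    qed
  qed
qed

text \<open>The negated \<open>n - 1\<close> critical values are roots, counted with at most their
  true multiplicity. The derivative has degree \<open>n - 1\<close>, so no room is left for other
  roots.\<close>

lemma proots_pderiv_interlacing:
  fixes f \<mu> :: "nat \<Rightarrow> real"
  assumes f: "mono_on {1..n} f" and \<mu>: "\<And>i. i \<in> {1..n - 1} \<Longrightarrow> interlacing_critical n f i (\<mu> i)"
    and "n > 0"
  shows "image_mset uminus (proots (pderiv (\<Prod>j\<in>{1..n}. [:f j, 1:]))) = image_mset \<mu> (mset_set {1..n - 1})"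
proof -
  define P where "P = (\<Prod>j\<in>{1..n}. [:f j, 1:])"
  have "degree P = n"
    by (simp add: P_def degree_prod_sum_eq)
  with \<open>n > 0\<close> have "pderiv P \<noteq> 0"
    by (auto simp: pderiv_eq_0_iff)
  have "image_mset (\<lambda>i. - \<mu> i) (mset_set {1..n - 1}) \<subseteq># proots (pderiv P)"
  proof (rule mset_subset_eqI)
    fix x
    have "{i\<in>{1..n - 1}. - \<mu> i = x} = {i\<in>{1..n - 1}. \<mu> i = - x}"
      by auto
    then have "count (image_mset (\<lambda>i. - \<mu> i) (mset_set {1..n - 1})) x = card {i\<in>{1..n - 1}. \<mu> i = - x}"
      by (simp only: count_image_mset_set[OF finite_atLeastAtMost])
    also have "\<dots> \<le> order x (pderiv P)"
      using interlacing_critical_count_le[OF assms, of "- x"] by (simp add: P_def)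
    finally show "count (image_mset (\<lambda>i. - \<mu> i) (mset_set {1..n - 1})) x \<le> count (proots (pderiv P)) x"
      using \<open>pderiv P \<noteq> 0\<close> by simp
  qed
  moreover have "size (proots (pderiv P)) \<le> size (image_mset (\<lambda>i. - \<mu> i) (mset_set {1..n - 1}))"
    using size_proots_le[of "pderiv P"] by (simp add: degree_pderiv \<open>degree P = n\<close>)
  ultimately have "proots (pderiv P) = image_mset (\<lambda>i. - \<mu> i) (mset_set {1..n - 1})"
    by (metis mset_subset_size not_le subset_mset.le_imp_less_or_eq)
  then show ?thesis
    by (simp add: image_mset.compositionality comp_def del: One_nat_def flip: P_def)
qed

section \<open>Eigenvalues of the elementary symmetric function of degree n - 1\<close>

lemma subsets_card_diff_1:
  assumes "finite I" "I \<noteq> {}"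
  shows "{S. S \<subseteq> I \<and> card S = card I - 1} = (\<lambda>i. I - {i}) ` I"
proof (intro set_eqI iffI)
  fix S assume "S \<in> {S. S \<subseteq> I \<and> card S = card I - 1}"
  then have S: "S \<subseteq> I" "card S = card I - 1" by auto
  moreover have "card I > 0"
    using assms by (simp add: card_gt_0_iff)
  ultimately have "card (I - S) = 1"
    using assms(1) by (simp add: card_Diff_subset finite_subset)
  then obtain i where "I - S = {i}"
    by (auto simp: card_1_singleton_iff)
  then have "i \<in> I" "S = I - {i}"
    using S(1) by auto
  then show "S \<in> (\<lambda>i. I - {i}) ` I" by auto
qed (use assms in auto)

lemma sum_prod_subsets_card_diff_1:
  fixes g :: "'i \<Rightarrow> 'a::comm_semiring_1"
  assumes "finite I" "I \<noteq> {}"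
  shows "(\<Sum>S | S \<subseteq> I \<and> card S = card I - 1. \<Prod>i\<in>S. g i) = (\<Sum>i\<in>I. \<Prod>j\<in>I - {i}. g j)"
  unfolding subsets_card_diff_1[OF assms]
  by (subst sum.reindex) (auto simp: inj_on_def)

lemma sigma_pred_card:
  fixes A :: "real^'n^'n"
  shows "sigma (CARD('n) - 1) A = (\<Sum>i = 1..CARD('n). \<Prod>j\<in>{1..CARD('n)} - {i}. eigval j A)"
  using sum_prod_subsets_card_diff_1[of "{1..CARD('n)}" "\<lambda>j. eigval j A"] by (simp add: sigma_def)

lemma sigma_card:
  fixes A :: "real^'n^'n"
  shows "sigma CARD('n) A = (\<Prod>i = 1..CARD('n). eigval i A)"
proof -
  have "S = {1..CARD('n)}" if "S \<subseteq> {1..CARD('n)}" "card S = CARD('n)" for S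
    using that by (intro card_subset_eq) auto
  then have "{S. S \<subseteq> {1..CARD('n)} \<and> card S = CARD('n)} = {{1..CARD('n)}}"
    by auto
  then show ?thesis
    unfolding sigma_def by (simp only: sum.insert finite.emptyI empty_iff sum.empty) simp
qed

text \<open>The shift by \<open>mat t\<close> adds \<open>t\<close> to every eigenvalue, and the
  products with one factor left out sum to a derivative.\<close>

lemma sigma_poly_eq:
  fixes A :: "real^'n^'n"
  assumes "A \<in> Sym2"
  shows "sigma_poly A = pderiv (\<Prod>j\<in>{1..CARD('n)}. [:eigval j A, 1:])"
proof -
  have shift: "poly (pderiv (\<Prod>j\<in>{1..CARD('n)}. [:eigval j A, 1:])) t = sigma (CARD('n) - 1) (mat t + A)" for t
    unfolding sigma_pred_card poly_pderiv_prod_linear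
    using assms by (intro sum.cong prod.cong refl) (simp add: eigval_add_mat add.commute[of "mat t"])
  show ?thesis
    unfolding sigma_poly_def
  proof (rule the_equality)
    show "\<forall>t. poly (pderiv (\<Prod>j\<in>{1..CARD('n)}. [:eigval j A, 1:])) t = sigma (CARD('n) - 1) (mat t + A)"
      using shift by blast
    show "p = pderiv (\<Prod>j\<in>{1..CARD('n)}. [:eigval j A, 1:])"
      if "\<forall>t. poly p t = sigma (CARD('n) - 1) (mat t + A)" for p
      using that shift by (simp add: fun_eq_iff flip: poly_eq_poly_eq_iff)
  qed
qed

text \<open>This predicate replaces the definition of \<open>sigma_eigval\<close> in what follows.
  Critical values of successive gaps increase, so the sorted list returns them in the order of the
  gaps.\<close>

lemma interlacing_critical_sigma_eigval:
  fixes A :: "real^'n^'n"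
  assumes A: "A \<in> Sym2" and k: "k \<in> {1..CARD('n) - 1}"
  shows "interlacing_critical CARD('n) (\<lambda>i. eigval i A) k (sigma_eigval k A)"
proof -
  let ?n = "CARD('n)" and ?f = "\<lambda>i. eigval i A"
  note f = eigval_mono[OF A]
  obtain \<mu> where \<mu>: "\<And>i. i \<in> {1..?n - 1} \<Longrightarrow> interlacing_critical ?n ?f i (\<mu> i)"
    using interlacing_critical_exists[OF f] by metis
  have "mono_on {1..?n - 1} \<mu>"
  proof (rule mono_onI)
    fix i j assume ij: "i \<in> {1..?n - 1}" "j \<in> {1..?n - 1}" "i \<le> j"
    show "\<mu> i \<le> \<mu> j"
    proof (cases "i = j")
      case False
      then have "?f (i + 1) \<le> ?f j"
        using f ij by (auto simp: monotone_on_def)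
      then show ?thesis
        using interlacing_critical_bounds[OF \<mu>[OF ij(1)]] interlacing_critical_bounds[OF \<mu>[OF ij(2)]] by linarith
    qed simp
  qed
  then have "sorted_list_of_multiset (image_mset \<mu> (mset_set {1..?n - 1})) ! (k - 1) = \<mu> k"
    using k by (rule sorted_list_of_image_mset_nth)
  then have "sigma_eigval k A = \<mu> k"
    using proots_pderiv_interlacing[OF f \<mu>] by (simp add: sigma_eigval_def sigma_poly_eq[OF A])
  then show ?thesis
    using \<mu>[OF k] by simp
qed

text \<open>Inside a gap no denominator changes sign, so each term increases strictly with the
  point.\<close>

lemma sum_reciprocal_strict_mono:
  fixes f :: "nat \<Rightarrow> real"
  assumes f: "mono_on {1..n} f" and i: "i \<in> {1..n - 1}"
    and "f i < x" "x < y" "y < f (i + 1)"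
  shows "(\<Sum>j = 1..n. 1 / (f j - x)) < (\<Sum>j = 1..n. 1 / (f j - y))"
proof (rule sum_strict_mono)
  fix j assume j: "j \<in> {1..n}"
  show "1 / (f j - x) < 1 / (f j - y)"
  proof (cases "j \<le> i")
    case True
    then have "f j < x"
      using gap_avoids_values(1)[OF f i _ _ j, of x] assms by auto
    then show ?thesis
      using \<open>x < y\<close> by (intro divide_strict_left_mono) (auto simp: mult_neg_neg)
  next
    case False
    then have "y < f j"
      using gap_avoids_values(2)[OF f i _ _ j, of y] assms by auto
    then show ?thesis
      using \<open>x < y\<close> by (intro divide_strict_left_mono) (auto simp: mult_pos_pos)
  qed
qed (use i in auto)

text \<open>The gap is nonempty because it contains \<open>x\<close>, so \<open>m\<close> is a zero
  of the reciprocal sum, which increases strictly across the gap.\<close>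

lemma interlacing_critical_compare:
  fixes f :: "nat \<Rightarrow> real"
  assumes f: "mono_on {1..n} f" and i: "i \<in> {1..n - 1}" and m: "interlacing_critical n f i m"
    and x: "f i < x" "x < f (i + 1)"
  shows "(\<Sum>j = 1..n. 1 / (f j - x)) < 0 \<longleftrightarrow> x < m"
    and "(\<Sum>j = 1..n. 1 / (f j - x)) > 0 \<longleftrightarrow> m < x"
proof -
  have m: "f i < m" "m < f (i + 1)" "(\<Sum>j = 1..n. 1 / (f j - m)) = 0"
    using m x by (auto simp: interlacing_critical_def)
  have "x < m \<Longrightarrow> (\<Sum>j = 1..n. 1 / (f j - x)) < 0" "m < x \<Longrightarrow> (\<Sum>j = 1..n. 1 / (f j - x)) > 0"
    using sum_reciprocal_strict_mono[OF f i x(1), of m] sum_reciprocal_strict_mono[OF f i m(1), of x] x m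
    by auto
  then show "(\<Sum>j = 1..n. 1 / (f j - x)) < 0 \<longleftrightarrow> x < m" "(\<Sum>j = 1..n. 1 / (f j - x)) > 0 \<longleftrightarrow> m < x"
    using m(3) by (metis less_irrefl less_asym linorder_neqE)+
qed

lemma interlacing_critical_unique:
  fixes f :: "nat \<Rightarrow> real"
  assumes f: "mono_on {1..n} f" and i: "i \<in> {1..n - 1}"
    and m: "interlacing_critical n f i m" and m': "interlacing_critical n f i m'"
  shows "m = m'"
proof (cases "f i = f (i + 1)")
  case False
  then have "f i < m'" "m' < f (i + 1)" "(\<Sum>j = 1..n. 1 / (f j - m')) = 0"
    using m' by (auto simp: interlacing_critical_def)
  then show ?thesis
    using interlacing_critical_compare[OF f i m] by (metis less_irrefl linorder_neqE)
qed (use m m' in \<open>auto simp: interlacing_critical_def\<close>)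

text \<open>Both alternatives of the predicate are invariant under shifts, so the shifted value is
  critical for the shifted matrix and uniqueness identifies it.\<close>

lemma sigma_eigval_add_mat:
  fixes A :: "real^'n^'n"
  assumes A: "A \<in> Sym2" and k: "k \<in> {1..CARD('n) - 1}"
  shows "sigma_eigval k (A + mat s) = sigma_eigval k A + s"
proof (rule interlacing_critical_unique[OF eigval_mono[OF Sym2_add_mat[OF A, of s]] k])
  show "interlacing_critical CARD('n) (\<lambda>i. eigval i (A + mat s)) k (sigma_eigval k (A + mat s))"
    by (intro interlacing_critical_sigma_eigval Sym2_add_mat A k)
  have "(\<Sum>j = 1..CARD('n). 1 / (eigval j (A + mat s) - (x + s))) = (\<Sum>j = 1..CARD('n). 1 / (eigval j A - x))" for x
    using A by (intro sum.cong refl) (simp add: eigval_add_mat)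
  then show "interlacing_critical CARD('n) (\<lambda>i. eigval i (A + mat s)) k (sigma_eigval k A + s)"
    using interlacing_critical_sigma_eigval[OF A k] k A
    by (auto simp add: interlacing_critical_def eigval_add_mat simp del: One_nat_def)
qed

subsection \<open>The asymptotic interior\<close>

text \<open>A shift by half of a positive \<open>eigval k A\<close> keeps the limit above
  \<open>\<theta>\<close>. If that eigenvalue is not positive, every positive shift makes the first
  \<open>k\<close> negative and the limit falls below \<open>\<theta>\<close>.\<close>

lemma asymp_interior_F_arctan_noncritical:
  fixes \<theta> :: real
  assumes k: "k \<in> {1..CARD('n)}"
    and lower: "(real CARD('n) - 2 * real k) * (pi / 2) < \<theta>"
    and upper: "\<theta> < (real CARD('n) - 2 * (real k - 1)) * (pi / 2)"
  shows "asymp_interior (F_arctan \<theta> :: (real^'n^'n) set) = {A \<in> Sym2. eigval k A > 0}"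
proof -
  let ?n = "CARD('n)"
  have "A \<in> asymp_interior (F_arctan \<theta>) \<longleftrightarrow> eigval k A > 0" if A: "A \<in> Sym2" for A :: "real^'n^'n"
  proof -
    define \<nu> where "\<nu> e i = eigval i A - e" for e i
    have \<nu>: "mono_on {1..?n} (\<nu> e)" for e
      using eigval_mono[OF A] by (simp add: \<nu>_def monotone_on_def)
    have "\<exists>e>0. \<forall>\<^sub>F t in at_top. \<theta> \<le> (\<Sum>i = 1..?n. arctan (t * \<nu> e i))" if pos: "eigval k A > 0"
    proof (intro exI conjI)
      have "real ?n - 2 * (real k - 1) \<le> (\<Sum>i = 1..?n. sgn (\<nu> (eigval k A / 2) i))"
        using pos by (intro sum_sgn_ge[OF \<nu> k]) (simp add: \<nu>_def)
      then have "\<theta> < (\<Sum>i = 1..?n. sgn (\<nu> (eigval k A / 2) i)) * (pi / 2)"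
        by (intro less_le_trans[OF upper] mult_right_mono) auto
      from order_tendstoD(1)[OF tendsto_sum_arctan this]
      show "\<forall>\<^sub>F t in at_top. \<theta> \<le> (\<Sum>i = 1..?n. arctan (t * \<nu> (eigval k A / 2) i))"
        by (rule eventually_mono) simp
    qed (use pos in auto)
    moreover have "\<not> (\<forall>\<^sub>F t in at_top. \<theta> \<le> (\<Sum>i = 1..?n. arctan (t * \<nu> e i)))"
      if "\<not> eigval k A > 0" "e > 0" for e
    proof
      assume ev: "\<forall>\<^sub>F t in at_top. \<theta> \<le> (\<Sum>i = 1..?n. arctan (t * \<nu> e i))"
      have "\<theta> \<le> (\<Sum>i = 1..?n. sgn (\<nu> e i)) * (pi / 2)"
        by (rule tendsto_lowerbound[OF tendsto_sum_arctan ev]) simp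
      also have "\<dots> \<le> (real ?n - 2 * real k) * (pi / 2)"
        using that by (intro mult_right_mono sum_sgn_le[OF \<nu> k]) (auto simp: \<nu>_def)
      finally show False
        using lower by simp
    qed
    ultimately show ?thesis
      unfolding asymp_interior_F_arctan[OF A] \<nu>_def by blast
  qed
  then show ?thesis
    by (auto simp: asymp_interior_def)
qed

lemma sum_sgn_eq:
  fixes f :: "nat \<Rightarrow> real"
  assumes "mono_on {1..n} f" "k \<in> {1..n - 1}" "f k < 0" "f (k + 1) > 0"
  shows "(\<Sum>i = 1..n. sgn (f i)) = real n - 2 * real k"
proof -
  have "k \<in> {1..n}" "k + 1 \<in> {1..n}"
    using assms(2) by auto
  then show ?thesis
    using sum_sgn_le[of n f k] sum_sgn_ge[of n f "k + 1"] assms by simp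
qed

text \<open>Either \<open>k + 1\<close> values are negative, which lowers the bound by 2, or the
  value at \<open>k + 1\<close> is 0 and contributes 0 instead of 1.\<close>

lemma sum_sgn_less:
  fixes f :: "nat \<Rightarrow> real"
  assumes f: "mono_on {1..n} f" and k: "k \<in> {1..n - 1}" and "f k < 0" "f (k + 1) \<le> 0"
  shows "(\<Sum>i = 1..n. sgn (f i)) < real n - 2 * real k"
proof (cases "f (k + 1) < 0")
  case True
  have "k + 1 \<in> {1..n}"
    using k by auto
  then show ?thesis
    using sum_sgn_le[OF f _ True] by simp
next
  case False
  have "f i < 0" if "i \<in> {1..k}" for i
    using f k that by (intro le_less_trans[OF _ assms(3)]) (auto simp: monotone_on_def)
  then have "(\<Sum>i = 1..k. sgn (f i)) = - real k"
    by simp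
  moreover have "(\<Sum>i = k+2..n. sgn (f i)) \<le> (\<Sum>i = k+2..n. 1)"
    by (intro sum_mono) (simp add: sgn_if)
  moreover have "f (k + 1) = 0"
    using False assms(4) by simp
  moreover have "k + 1 \<le> n"
    using k by auto
  ultimately show ?thesis
    using sum_split_at[of k n "\<lambda>i. sgn (f i)"] sum.atLeast_Suc_atMost[of "k + 1" n "\<lambda>i. sgn (f i)"]
    by (simp add: of_nat_diff)
qed

text \<open>A shift strictly between \<open>eigval k A\<close> and \<open>eigval (k + 1) A\<close>
  makes the limit equal to \<open>\<theta>\<close>, so the reciprocal sum decides. Below this gap
  the limit is larger than \<open>\<theta>\<close>, beyond it smaller.\<close>

lemma asymp_interior_F_arctan_critical:
  fixes \<theta> :: real
  assumes k: "k \<in> {1..CARD('n) - 1}" and \<theta>: "\<theta> = (real CARD('n) - 2 * real k) * (pi / 2)"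
  shows "asymp_interior (F_arctan \<theta> :: (real^'n^'n) set) = {A \<in> Sym2. sigma_eigval k A > 0}"
proof -
  let ?n = "CARD('n)"
  have "A \<in> asymp_interior (F_arctan \<theta>) \<longleftrightarrow> sigma_eigval k A > 0" if A: "A \<in> Sym2" for A :: "real^'n^'n"
  proof -
    define m where "m = sigma_eigval k A"
    define \<nu> where "\<nu> e i = eigval i A - e" for e i
    have \<nu>: "mono_on {1..?n} (\<nu> e)" for e
      using eigval_mono[OF A] by (simp add: \<nu>_def monotone_on_def)
    have m: "interlacing_critical ?n (\<lambda>i. eigval i A) k m"
      unfolding m_def by (rule interlacing_critical_sigma_eigval[OF A k])
    note compare = interlacing_critical_compare[OF eigval_mono[OF A] k m]
    have critical: "\<theta> = (\<Sum>i = 1..?n. sgn (\<nu> e i)) * (pi / 2)" and nz: "\<And>i. i \<in> {1..?n} \<Longrightarrow> \<nu> e i \<noteq> 0"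
      if "eigval k A < e" "e < eigval (k + 1) A" for e
    proof -
      show "\<theta> = (\<Sum>i = 1..?n. sgn (\<nu> e i)) * (pi / 2)"
        unfolding \<theta> by (subst sum_sgn_eq[OF \<nu> k]) (use that in \<open>auto simp: \<nu>_def\<close>)
      show "\<nu> e i \<noteq> 0" if "i \<in> {1..?n}" for i
        using gap_avoids_values(3)[OF eigval_mono[OF A] k \<open>eigval k A < e\<close> \<open>e < _\<close> that]
        by (simp add: \<nu>_def)
    qed
    have "\<exists>e>0. \<forall>\<^sub>F t in at_top. \<theta> \<le> (\<Sum>i = 1..?n. arctan (t * \<nu> e i))" if "m > 0"
    proof (cases "eigval k A > 0")
      case True
      have "k \<in> {1..?n}" "\<theta> < (real ?n - 2 * (real k - 1)) * (pi / 2)"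
        using k by (auto simp: \<theta>)
      then have "real ?n - 2 * (real k - 1) \<le> (\<Sum>i = 1..?n. sgn (\<nu> (eigval k A / 2) i))"
        using True by (intro sum_sgn_ge[OF \<nu>]) (auto simp: \<nu>_def)
      then have "\<theta> < (\<Sum>i = 1..?n. sgn (\<nu> (eigval k A / 2) i)) * (pi / 2)"
        by (intro less_le_trans[OF \<open>\<theta> < _\<close>] mult_right_mono) auto
      from order_tendstoD(1)[OF tendsto_sum_arctan this] True show ?thesis
        by (intro exI[of _ "eigval k A / 2"]) (auto elim: eventually_mono)
    next
      case False
      with m \<open>m > 0\<close> have "m < eigval (k + 1) A"
        by (auto simp: interlacing_critical_def)
      have "max 0 (eigval k A) < m"
        using m False \<open>m > 0\<close> by (auto simp: interlacing_critical_def)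
      \<comment> \<open>Positive as the asymptotic interior demands, inside the gap, and below
        \<open>m\<close>, where the reciprocal sum is negative.\<close>
      then obtain e where e: "max 0 (eigval k A) < e" "e < m"
        using dense by blast
      then have gap: "eigval k A < e" "e < eigval (k + 1) A"
        using \<open>m < _\<close> by auto
      have "(\<Sum>i = 1..?n. 1 / \<nu> e i) < 0"
        using compare(1)[OF gap] e(2) by (simp add: \<nu>_def)
      then have "\<forall>\<^sub>F t in at_top. \<theta> \<le> (\<Sum>i = 1..?n. arctan (t * \<nu> e i))"
        using nz[OF gap] critical[OF gap] by (intro eventually_critical_sum_arctan(1)) auto
      with e(1) show ?thesis by auto
    qed
    moreover have "\<not> (\<forall>\<^sub>F t in at_top. \<theta> \<le> (\<Sum>i = 1..?n. arctan (t * \<nu> e i)))"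
      if "\<not> m > 0" "e > 0" for e
    proof
      assume ev: "\<forall>\<^sub>F t in at_top. \<theta> \<le> (\<Sum>i = 1..?n. arctan (t * \<nu> e i))"
      \<comment> \<open>As \<open>eigval k A \<le> m\<close> and \<open>m \<le> 0\<close>, every
        positive shift exceeds \<open>eigval k A\<close>. It lies either in the gap to the right of
        \<open>m\<close>, or at or past the upper end, where the limit is below
        \<open>\<theta>\<close>.\<close>
      have lt: "eigval k A < e"
        using that interlacing_critical_bounds[OF m] by linarith
      show False
      proof (cases "e < eigval (k + 1) A")
        case True
        have "(\<Sum>i = 1..?n. 1 / \<nu> e i) > 0"
          using compare(2)[OF lt True] that by (simp add: \<nu>_def)
        then have "\<forall>\<^sub>F t in at_top. (\<Sum>i = 1..?n. arctan (t * \<nu> e i)) < \<theta>"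
          using nz[OF lt True] critical[OF lt True] by (intro eventually_critical_sum_arctan(2)) auto
        with ev have "\<forall>\<^sub>F t :: real in at_top. False"
          by eventually_elim simp
        then show False by simp
      next
        case False
        have "\<theta> \<le> (\<Sum>i = 1..?n. sgn (\<nu> e i)) * (pi / 2)"
          by (rule tendsto_lowerbound[OF tendsto_sum_arctan ev]) simp
        also have "\<dots> < (real ?n - 2 * real k) * (pi / 2)"
          using lt False by (intro mult_strict_right_mono sum_sgn_less[OF \<nu> k]) (auto simp: \<nu>_def)
        finally show False
          by (simp add: \<theta>)
      qed
    qed
    ultimately show ?thesis
      unfolding asymp_interior_F_arctan[OF A] \<nu>_def m_def by blast
  qed
  then show ?thesis
    by (auto simp: asymp_interior_def)
qed

text \<open>Interlacing settles the sign unless 0 lies strictly inside the gap. There the product of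
  the two symmetric functions is a positive square times the reciprocal sum at 0, whose sign places
  the critical value relative to 0.\<close>

lemma sigma_eigval_pos_iff:
  fixes A :: "real^'n^'n"
  assumes A: "A \<in> Sym2" and k: "k \<in> {1..CARD('n) - 1}"
  shows "sigma_eigval k A > 0 \<longleftrightarrow>
    eigval (k + 1) A > 0 \<and> (eigval k A \<ge> 0 \<or> sigma (CARD('n) - 1) A * sigma CARD('n) A < 0)"
proof -
  note m = interlacing_critical_sigma_eigval[OF A k]
  consider "eigval (k + 1) A \<le> 0" | "eigval (k + 1) A > 0" "eigval k A \<ge> 0"
    | "eigval k A < 0" "0 < eigval (k + 1) A"
    by linarith
  then show ?thesis
  proof cases
    case 1
    then show ?thesis
      using interlacing_critical_bounds[OF m] by auto
  next
    case 2
    then show ?thesis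
      using m by (auto simp: interlacing_critical_def)
  next
    case 3
    have nz: "eigval i A \<noteq> 0" if "i \<in> {1..CARD('n)}" for i
      using gap_avoids_values(3)[OF eigval_mono[OF A] k 3 that] .
    have "sigma (CARD('n) - 1) A * sigma CARD('n) A =
        (sigma CARD('n) A)\<^sup>2 * (\<Sum>i = 1..CARD('n). 1 / eigval i A)"
      unfolding sigma_pred_card sigma_card
      by (subst sum_prod_remove) (use nz in \<open>auto simp: power2_eq_square\<close>)
    moreover have "sigma CARD('n) A \<noteq> 0"
      using nz by (simp add: sigma_card)
    ultimately have "sigma (CARD('n) - 1) A * sigma CARD('n) A < 0 \<longleftrightarrow> (\<Sum>i = 1..CARD('n). 1 / eigval i A) < 0"
      by (simp add: mult_less_0_iff)
    also have "\<dots> \<longleftrightarrow> 0 < sigma_eigval k A"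
      using interlacing_critical_compare(1)[OF eigval_mono[OF A] k m 3] by simp
    finally show ?thesis
      using 3 by auto
  qed
qed

theorem theorem4p6:
  fixes \<theta> :: real
  assumes "- real CARD('n) * (pi / 2) < \<theta>" and "\<theta> < real CARD('n) * (pi / 2)"
  shows "(\<forall>k\<in>{1..CARD('n)}.
            \<theta> \<in> {(real CARD('n) - 2 * real k) * (pi / 2) <..<
                 (real CARD('n) - 2 * (real k - 1)) * (pi / 2)} \<longrightarrow>
            Int_Sym (asymp_subeq (F_arctan \<theta> :: (real^'n^'n) set)) = Int_Sym (Lam k) \<and>
            Int_Sym (Lam k :: (real^'n^'n) set) = {A \<in> Sym2. eigval k A > 0}) \<and>
         (\<forall>k\<in>{1..CARD('n) - 1}.
            \<theta> = (real CARD('n) - 2 * real k) * (pi / 2) \<longrightarrow>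
            Int_Sym (asymp_subeq (F_arctan \<theta> :: (real^'n^'n) set)) = Int_Sym (sigma_Lam k) \<and>
            Int_Sym (asymp_subeq (F_arctan \<theta> :: (real^'n^'n) set)) =
              (Int_Sym (Lam (k + 1)) \<inter> Lam k) \<union> E_star k)"
proof (intro conjI ballI impI)
  fix k assume k: "k \<in> {1..CARD('n)}"
    and \<theta>: "\<theta> \<in> {(real CARD('n) - 2 * real k) * (pi / 2) <..<
      (real CARD('n) - 2 * (real k - 1)) * (pi / 2)}"
  show Int_Lam: "Int_Sym (Lam k :: (real^'n^'n) set) = {A \<in> Sym2. eigval k A > 0}"
    using k by (rule Int_Sym_Lam)
  show "Int_Sym (asymp_subeq (F_arctan \<theta> :: (real^'n^'n) set)) = Int_Sym (Lam k)"
    unfolding Int_Lam Int_Sym_asymp_subeq_F_arctan(1)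
    using k \<theta> by (intro asymp_interior_F_arctan_noncritical) auto
next
  fix k assume k: "k \<in> {1..CARD('n) - 1}" and \<theta>: "\<theta> = (real CARD('n) - 2 * real k) * (pi / 2)"
  let ?U = "{A :: real^'n^'n. A \<in> Sym2 \<and> sigma_eigval k A > 0}"
  have U: "asymp_interior (F_arctan \<theta>) = ?U"
    using k \<theta> by (rule asymp_interior_F_arctan_critical)
  \<comment> \<open>The shape of the closure of \<open>?U\<close>, because
    \<open>sigma_eigval\<close> shifts with the matrix.\<close>
  have "sigma_Lam k = {A \<in> Sym2. \<forall>s>0. A + mat s \<in> ?U}"
    using k nonneg_iff_add_pos by (auto simp: sigma_Lam_def Sym2_add_mat sigma_eigval_add_mat)
  then have "Int_Sym (sigma_Lam k) = ?U"
    using Int_Sym_asymp_subeq_F_arctan(2)[of \<theta>, where 'n = 'n] by (simp only: U)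
  then show "Int_Sym (asymp_subeq (F_arctan \<theta> :: (real^'n^'n) set)) = Int_Sym (sigma_Lam k)"
    by (simp add: Int_Sym_asymp_subeq_F_arctan(1) U)
  have "k + 1 \<in> {1..CARD('n)}"
    using k by auto
  then have "?U = (Int_Sym (Lam (k + 1)) \<inter> Lam k) \<union> E_star k"
    using sigma_eigval_pos_iff[OF _ k] unfolding E_star_def Int_Sym_Lam[OF \<open>k + 1 \<in> _\<close>] by (auto simp: Lam_def)
  then show "Int_Sym (asymp_subeq (F_arctan \<theta> :: (real^'n^'n) set)) =
      (Int_Sym (Lam (k + 1)) \<inter> Lam k) \<union> E_star k"
    by (simp add: Int_Sym_asymp_subeq_F_arctan(1) U)
qed

end
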